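(* Suppose that each function symbol has arity at most two. Consider an action $a$ with arity $k\ge 2$ where each numeric constraint $c$ in the precondition $\mathit{pre}(a)$ has an arity of at most $2$, and a state $\mathcal{S}$. Let $\mathcal{G}=\langle\mathcal{V},\mathcal{E}\rangle$ be the substitution consistency graph in which numeric constraints are treated by the interval-based relaxation using assignment sets, i.e. with $\mathcal{E}=\mathcal{V}^2\setminus(\mathcal{I}^{\neq}\cup\mathcal{I}^{+}\cup\mathcal{I}^{-}\cup\widehat{\mathcal{I}}^{\Delta})$. Then, there exists a $k$-clique $\mathcal{C}=\{v_1,\ldots,v_k\}$ in $\mathcal{G}$ iff all ground numeric constraints $\overline{c}=c[v_1,\ldots,v_k]$ with $c$ in $\mathit{pre}(a)$ hold in $\mathcal{S}$.
   Context: **Syntax.** Fix sets of predicate symbols and function symbols, each symbol with an arity in $\mathbb{N}$, and a set $\mathcal{O}$ of objects (constants). An atom is $P(t_1,\ldots,t_m)$ with $P$ a predicate symbol of arity $m$ and each $t_i$ a variable or an object; a literal is an atom $p$ or its negation $\neg p$. A function term is $F(t_1,\ldots,t_m)$ with $F$ a function symbol of arity $m$ and each $t_i$ a variable or an object. A function expression is any expression built from function terms using the arithmetic operators $+,-,\times,\div$. A numeric constraint is $e\oplus e'$ with $e,e'$ function expressions and $\oplus\in\{=,<,>,\le,\ge\}$. For a syntactic element $y$ (atom, literal, constraint, action, ...), $\mathcal{X}(y)$ is its set of free variables and its arity is $|\mathcal{X}(y)|$; $y$ is ground iff $\mathcal{X}(y)=\emptyset$. **Substitutions.** A substitution function is a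 map $\rho$ from a set of variables to $\mathcal{O}$; $\mathcal{R}(\mathcal{X},\mathcal{O})$ is the set of those with domain $\mathcal{X}$. One writes $x_1/o_1,\ldots,x_n/o_n$ for the $\rho$ with $\rho(x_i)=o_i$, and $\rho\subseteq\rho'$ iff $\rho'$ extends $\rho$. $y[\rho]$ denotes $y$ with every occurrence of each variable in the domain of $\rho$ replaced by its image. **States.** A state $\mathcal{S}$ consists of a set of ground atoms (those that hold in $\mathcal{S}$) and a set of ground function terms $\overline f$, each with an associated real value $\overline f(\mathcal{S})$; ground function terms not in this set are undefined. The value of a ground function expression or ground numeric constraint in $\mathcal{S}$ is defined in the usual way from the values of its ground function terms. A ground numeric constraint holds in $\mathcal{S}$ iff it evaluates to true. **Actions.** An action $a$ has a precondition $\mathit{pre}(a)$, a set of literals and numeric constraints, and a set of effects. $\mathit{pre}^+(a)$ and $\mathit{pre}^-(a)$ are the sets of atoms of the positive and negative literals in $\mathit{pre}(a)$, and $\mathit{pre}^{\Delta}(a)$ is the set of numeric constraints in $\mathit{pre}(a)$. **Intervals.** Let $\overline{\mathbb{R}}=\mathbb{R}\cup\{-\infty,+\infty\}$. Intervals are the closed intervals $[\alpha,\beta]=\{r\in\overline{\mathbb{R}}\mid \alpha\le r\le\beta\}$ with $\alpha\le\beta$ in $\overline{\mathbb{R}}$, and $\emptyset$. $\mathit{hull}(S)=[\inf S,\sup S]$ for nonempty $S$, and $\mathit{hull}(\emptyset)=\emptyset$. For $\odot\in\{+,-,\times,\div\}$, $J\odot J'=\mathit{hull}(\{r\odot s\mid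 r\in J,\,s\in J',\ r\odot s\text{ is defined}\})$. For a comparison $\oplus$, $J\oplus J'$ is true iff there are $r\in J$, $s\in J'$ with $r\oplus s$ true, and false otherwise. **Assignment sets.** For a function symbol $F$ of arity $m$ with generic term $f=F(z_1,\ldots,z_m)$ over distinct variables $Z=\{z_1,\ldots,z_m\}$, and $\rho\in\mathcal{R}(Z',\mathcal{O})$ with $Z'\subseteq Z$, let $\lambda_{F,\mathcal{S}}(\rho)=\mathit{hull}(\{f[\rho'](\mathcal{S})\mid\rho'\in\mathcal{R}(Z,\mathcal{O}),\ \rho\subseteq\rho'\})$, where undefined ground function terms $f[\rho']$ contribute no value. **Relaxed evaluation.** For a numeric constraint $c=e\oplus e'$ and a pair $\{v,v'\}$ of vertices: evaluate each function term $F(t_1,\ldots,t_m)$ of $c[v,v']$ to the interval $\lambda_{F,\mathcal{S}}(\rho)$, where $\rho(z_i)=t_i$ for exactly those $i$ such that $t_i$ is an object; combine these intervals by interval arithmetic to obtain an interval for each of the two sides; finally apply the interval comparison $\oplus$. **Graph.** $\mathcal{V}=\{x/o\mid x\in\mathcal{X}(a),\,o\in\mathcal{O}\}$; edges are unordered pairs $\{v,v'\}$, and $\mathcal{E}=\mathcal{V}^2\setminus(\mathcal{I}^{\neq}\cup\mathcal{I}^{+}\cup\mathcal{I}^{-}\cup\widehat{\mathcal{I}}^{\Delta})$, where - $\mathcal{I}^{\neq}=\{\{x/o_1,x/o_2\}\mid x\in\mathcal{X}(a),\,o_1,o_2\in\mathcal{O}\}$; - $\mathcal{I}^{+}$ is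 the set of $\{v,v'\}$ with $v,v'\in\mathcal{V}$ for which there is $p\in\mathit{pre}^+(a)$ such that $p[v,v']$ matches no ground atom of $\mathcal{S}$; here $P(t_1,\ldots,t_m)$ matches $P'(t_1',\ldots,t_m')$ iff $P=P'$ and for each $i$, $t_i$ or $t_i'$ is a variable, or else $t_i=t_i'$; - $\mathcal{I}^{-}$ is the set of $\{v,v'\}$ with $v,v'\in\mathcal{V}$ for which there is $p\in\mathit{pre}^-(a)$ such that $p[v,v']$ is ground and is an atom of $\mathcal{S}$; - $\widehat{\mathcal{I}}^{\Delta}$ is the set of $\{v,v'\}$ with $v,v'\in\mathcal{V}$ for which there is $c\in\mathit{pre}^{\Delta}(a)$ whose relaxed evaluation under $\{v,v'\}$ is false. A $k$-clique is a set of $k$ distinct, pairwise adjacent vertices.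
   Formalization: As written, "if" fails (precondition P(x,y), no constraints, empty state: no clique). The right side here also requires {v_1,...,v_k} to be a k-clique of the graph with edges V^2 minus I^≠, I^+, I^- (numeric constraints ignored), which every k-clique of G is. *)

theory Defs
  imports "HOL-Library.Extended_Real"
begin

datatype ('x, 'o) trm = is_Var: Var 'x | Obj (the_obj: 'o)

datatype ('p, 'x, 'o) atom = Atom 'p "('x, 'o) trm list"

datatype ('p, 'x, 'o) literal = Pos "('p, 'x, 'o) atom" | Neg "('p, 'x, 'o) atom"

datatype ('f, 'x, 'o) fterm = FTerm 'f "('x, 'o) trm list"

datatype arith_op = OpAdd | OpSub | OpMul | OpDiv

datatype ('f, 'x, 'o) fexpr =
    FT "('f, 'x, 'o) fterm"
  | Arith arith_op "('f, 'x, 'o) fexpr" "('f, 'x, 'o) fexpr"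

datatype comparison = CEq | CLt | CGt | CLe | CGe

datatype ('f, 'x, 'o) constr =
  Constr comparison "('f, 'x, 'o) fexpr" "('f, 'x, 'o) fexpr"

datatype ('p, 'f, 'x, 'o) condition =
    Lit "('p, 'x, 'o) literal"
  | Num "('f, 'x, 'o) constr"

text \<open>Predicate and function symbols are the elements of the types \<open>'p\<close> and \<open>'f\<close>. The syntax of
  effects plays no role apart from the variables that occur in them, so effects are elements of
  an arbitrary type \<open>'e\<close> with an arbitrary assignment of free variables.\<close>

record ('p, 'f, 'x, 'o, 'e) lang =
  pred_arity :: "'p \<Rightarrow> nat"
  fun_arity :: "'f \<Rightarrow> nat"
  objs :: "'o set"
  eff_vars :: "'e \<Rightarrow> 'x set"

record ('p, 'f, 'x, 'o, 'e) action =
  pre :: "('p, 'f, 'x, 'o) condition set"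
  eff :: "'e set"

text \<open>The ground atom \<open>P(o\<^sub>1,\<dots>,o\<^sub>m)\<close> is represented by the pair \<open>(P, [o\<^sub>1,\<dots>,o\<^sub>m])\<close>, and likewise for
  ground function terms; \<open>None\<close> is the value of an undefined ground function term.\<close>

record ('p, 'f, 'o) state =
  facts :: "('p \<times> 'o list) set"
  fvals :: "'f \<times> 'o list \<Rightarrow> real option"

subsection \<open>Free variables\<close>

definition args_vars :: "('x, 'o) trm list \<Rightarrow> 'x set" where
  "args_vars ts = \<Union> (set1_trm ` set ts)"

fun atom_vars :: "('p, 'x, 'o) atom \<Rightarrow> 'x set" where
  "atom_vars (Atom P ts) = args_vars ts"

fun literal_vars :: "('p, 'x, 'o) literal \<Rightarrow> 'x set" where
  "literal_vars (Pos p) = atom_vars p"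
| "literal_vars (Neg p) = atom_vars p"

fun fterm_vars :: "('f, 'x, 'o) fterm \<Rightarrow> 'x set" where
  "fterm_vars (FTerm F ts) = args_vars ts"

fun fexpr_vars :: "('f, 'x, 'o) fexpr \<Rightarrow> 'x set" where
  "fexpr_vars (FT f) = fterm_vars f"
| "fexpr_vars (Arith b e e') = fexpr_vars e \<union> fexpr_vars e'"

fun constr_vars :: "('f, 'x, 'o) constr \<Rightarrow> 'x set" where
  "constr_vars (Constr r e e') = fexpr_vars e \<union> fexpr_vars e'"

fun condition_vars :: "('p, 'f, 'x, 'o) condition \<Rightarrow> 'x set" where
  "condition_vars (Lit l) = literal_vars l"
| "condition_vars (Num c) = constr_vars c"

definition action_vars ::
    "('p, 'f, 'x, 'o, 'e) lang \<Rightarrow> ('p, 'f, 'x, 'o, 'e) action \<Rightarrow> 'x set" where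
  "action_vars L a = (\<Union>q\<in>pre a. condition_vars q) \<union> (\<Union>e\<in>eff a. eff_vars L e)"

definition pos_pre :: "('p, 'f, 'x, 'o, 'e) action \<Rightarrow> ('p, 'x, 'o) atom set" where
  "pos_pre a = {p. Lit (Pos p) \<in> pre a}"

definition neg_pre :: "('p, 'f, 'x, 'o, 'e) action \<Rightarrow> ('p, 'x, 'o) atom set" where
  "neg_pre a = {p. Lit (Neg p) \<in> pre a}"

definition num_pre :: "('p, 'f, 'x, 'o, 'e) action \<Rightarrow> ('f, 'x, 'o) constr set" where
  "num_pre a = {c. Num c \<in> pre a}"

subsection \<open>Well-formedness with respect to arities and objects\<close>

definition wf_args :: "'o set \<Rightarrow> nat \<Rightarrow> ('x, 'o) trm list \<Rightarrow> bool" where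
  "wf_args Os m ts \<longleftrightarrow> length ts = m \<and> (\<forall>t\<in>set ts. set2_trm t \<subseteq> Os)"

fun wf_atom :: "('p, 'f, 'x, 'o, 'e) lang \<Rightarrow> ('p, 'x, 'o) atom \<Rightarrow> bool" where
  "wf_atom L (Atom P ts) = wf_args (objs L) (pred_arity L P) ts"

fun wf_fexpr :: "('p, 'f, 'x, 'o, 'e) lang \<Rightarrow> ('f, 'x, 'o) fexpr \<Rightarrow> bool" where
  "wf_fexpr L (FT (FTerm F ts)) = wf_args (objs L) (fun_arity L F) ts"
| "wf_fexpr L (Arith b e e') = (wf_fexpr L e \<and> wf_fexpr L e')"

fun wf_condition :: "('p, 'f, 'x, 'o, 'e) lang \<Rightarrow> ('p, 'f, 'x, 'o) condition \<Rightarrow> bool" where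
  "wf_condition L (Lit (Pos p)) = wf_atom L p"
| "wf_condition L (Lit (Neg p)) = wf_atom L p"
| "wf_condition L (Num (Constr r e e')) = (wf_fexpr L e \<and> wf_fexpr L e')"

definition wf_action ::
    "('p, 'f, 'x, 'o, 'e) lang \<Rightarrow> ('p, 'f, 'x, 'o, 'e) action \<Rightarrow> bool" where
  "wf_action L a \<longleftrightarrow> (\<forall>q\<in>pre a. wf_condition L q)"

definition wf_state :: "('p, 'f, 'x, 'o, 'e) lang \<Rightarrow> ('p, 'f, 'o) state \<Rightarrow> bool" where
  "wf_state L S \<longleftrightarrow>
     (\<forall>(P, os)\<in>facts S. length os = pred_arity L P \<and> set os \<subseteq> objs L) \<and>
     (\<forall>(F, os)\<in>dom (fvals S). length os = fun_arity L F \<and> set os \<subseteq> objs L)"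

subsection \<open>Substitutions\<close>

definition substs :: "'x set \<Rightarrow> 'o set \<Rightarrow> ('x \<rightharpoonup> 'o) set" where
  "substs X Os = {\<rho>. dom \<rho> = X \<and> ran \<rho> \<subseteq> Os}"

fun subst_trm :: "('x \<rightharpoonup> 'o) \<Rightarrow> ('x, 'o) trm \<Rightarrow> ('x, 'o) trm" where
  "subst_trm \<rho> (Var x) = (case \<rho> x of None \<Rightarrow> Var x | Some ob \<Rightarrow> Obj ob)"
| "subst_trm \<rho> (Obj ob) = Obj ob"

fun subst_atom :: "('x \<rightharpoonup> 'o) \<Rightarrow> ('p, 'x, 'o) atom \<Rightarrow> ('p, 'x, 'o) atom" where
  "subst_atom \<rho> (Atom P ts) = Atom P (map (subst_trm \<rho>) ts)"

fun subst_fterm :: "('x \<rightharpoonup> 'o) \<Rightarrow> ('f, 'x, 'o) fterm \<Rightarrow> ('f, 'x, 'o) fterm" where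
  "subst_fterm \<rho> (FTerm F ts) = FTerm F (map (subst_trm \<rho>) ts)"

fun subst_fexpr :: "('x \<rightharpoonup> 'o) \<Rightarrow> ('f, 'x, 'o) fexpr \<Rightarrow> ('f, 'x, 'o) fexpr" where
  "subst_fexpr \<rho> (FT f) = FT (subst_fterm \<rho> f)"
| "subst_fexpr \<rho> (Arith b e e') = Arith b (subst_fexpr \<rho> e) (subst_fexpr \<rho> e')"

fun subst_constr :: "('x \<rightharpoonup> 'o) \<Rightarrow> ('f, 'x, 'o) constr \<Rightarrow> ('f, 'x, 'o) constr" where
  "subst_constr \<rho> (Constr r e e') = Constr r (subst_fexpr \<rho> e) (subst_fexpr \<rho> e')"

subsection \<open>Evaluation in a state\<close>

text \<open>Division by zero is undefined, a term with an undefined (or non-ground) subterm is undefined,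
  and a constraint with an undefined side does not hold.\<close>

fun fterm_val :: "('p, 'f, 'o) state \<Rightarrow> ('f, 'x, 'o) fterm \<Rightarrow> real option" where
  "fterm_val S (FTerm F ts) =
     (if args_vars ts = {} then fvals S (F, map the_obj ts) else None)"

fun arith_real :: "arith_op \<Rightarrow> real \<Rightarrow> real \<Rightarrow> real option" where
  "arith_real OpAdd r s = Some (r + s)"
| "arith_real OpSub r s = Some (r - s)"
| "arith_real OpMul r s = Some (r * s)"
| "arith_real OpDiv r s = (if s = 0 then None else Some (r / s))"

fun fexpr_val :: "('p, 'f, 'o) state \<Rightarrow> ('f, 'x, 'o) fexpr \<Rightarrow> real option" where
  "fexpr_val S (FT f) = fterm_val S f"
| "fexpr_val S (Arith b e e') =
     (case (fexpr_val S e, fexpr_val S e') of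
        (Some r, Some s) \<Rightarrow> arith_real b r s
      | _ \<Rightarrow> None)"

fun compare :: "comparison \<Rightarrow> 'n::linorder \<Rightarrow> 'n \<Rightarrow> bool" where
  "compare CEq r s \<longleftrightarrow> r = s"
| "compare CLt r s \<longleftrightarrow> r < s"
| "compare CGt r s \<longleftrightarrow> r > s"
| "compare CLe r s \<longleftrightarrow> r \<le> s"
| "compare CGe r s \<longleftrightarrow> r \<ge> s"

fun constr_holds :: "('p, 'f, 'o) state \<Rightarrow> ('f, 'x, 'o) constr \<Rightarrow> bool" where
  "constr_holds S (Constr cmp e e') \<longleftrightarrow>
     (\<exists>r s. fexpr_val S e = Some r \<and> fexpr_val S e' = Some s \<and> compare cmp r s)"

subsection \<open>Interval arithmetic\<close>

definition interval_hull :: "ereal set \<Rightarrow> ereal set" where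
  "interval_hull A = (if A = {} then {} else {Inf A..Sup A})"

text \<open>Arithmetic on \<open>ereal\<close> is total; the usual indeterminate forms and division by zero are
  excluded here.\<close>

fun arith_ereal :: "arith_op \<Rightarrow> ereal \<Rightarrow> ereal \<Rightarrow> ereal option" where
  "arith_ereal OpAdd r s =
     (if r = \<infinity> \<and> s = -\<infinity> \<or> r = -\<infinity> \<and> s = \<infinity> then None else Some (r + s))"
| "arith_ereal OpSub r s =
     (if r = \<infinity> \<and> s = \<infinity> \<or> r = -\<infinity> \<and> s = -\<infinity> then None else Some (r - s))"
| "arith_ereal OpMul r s =
     (if r = 0 \<and> \<bar>s\<bar> = \<infinity> \<or> \<bar>r\<bar> = \<infinity> \<and> s = 0 then None else Some (r * s))"
| "arith_ereal OpDiv r s =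
     (if s = 0 \<or> \<bar>r\<bar> = \<infinity> \<and> \<bar>s\<bar> = \<infinity> then None else Some (r / s))"

definition interval_arith :: "arith_op \<Rightarrow> ereal set \<Rightarrow> ereal set \<Rightarrow> ereal set" where
  "interval_arith b J J' = interval_hull {t. \<exists>r\<in>J. \<exists>s\<in>J'. arith_ereal b r s = Some t}"

definition interval_compare :: "comparison \<Rightarrow> ereal set \<Rightarrow> ereal set \<Rightarrow> bool" where
  "interval_compare cmp J J' \<longleftrightarrow> (\<exists>r\<in>J. \<exists>s\<in>J'. compare cmp r s)"

subsection \<open>Assignment sets and relaxed evaluation\<close>

text \<open>The generic term of \<open>F\<close> uses the numbers \<open>0,\<dots>,m - 1\<close> as its distinct variables.\<close>

definition generic_fterm :: "('p, 'f, 'x, 'o, 'e) lang \<Rightarrow> 'f \<Rightarrow> ('f, nat, 'o) fterm" where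
  "generic_fterm L F = FTerm F (map Var [0..<fun_arity L F])"

definition assignment_set ::
    "('p, 'f, 'x, 'o, 'e) lang \<Rightarrow> ('p, 'f, 'o) state \<Rightarrow> 'f \<Rightarrow> (nat \<rightharpoonup> 'o) \<Rightarrow> ereal set" where
  "assignment_set L S F \<rho> =
     interval_hull {ereal r | r \<rho>'. \<rho>' \<in> substs {..<fun_arity L F} (objs L) \<and> \<rho> \<subseteq>\<^sub>m \<rho>' \<and>
                           fterm_val S (subst_fterm \<rho>' (generic_fterm L F)) = Some r}"

definition obj_positions :: "('x, 'o) trm list \<Rightarrow> (nat \<rightharpoonup> 'o)" where
  "obj_positions ts =
     (\<lambda>i. if i < length ts then (case ts ! i of Var x \<Rightarrow> None | Obj ob \<Rightarrow> Some ob) else None)"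

fun relaxed_fexpr ::
    "('p, 'f, 'x, 'o, 'e) lang \<Rightarrow> ('p, 'f, 'o) state \<Rightarrow> ('f, 'x, 'o) fexpr \<Rightarrow> ereal set" where
  "relaxed_fexpr L S (FT (FTerm F ts)) = assignment_set L S F (obj_positions ts)"
| "relaxed_fexpr L S (Arith b e e') =
     interval_arith b (relaxed_fexpr L S e) (relaxed_fexpr L S e')"

fun relaxed_constr ::
    "('p, 'f, 'x, 'o, 'e) lang \<Rightarrow> ('p, 'f, 'o) state \<Rightarrow> ('f, 'x, 'o) constr \<Rightarrow> bool" where
  "relaxed_constr L S (Constr cmp e e') \<longleftrightarrow>
     interval_compare cmp (relaxed_fexpr L S e) (relaxed_fexpr L S e')"

subsection \<open>The substitution consistency graph\<close>

text \<open>The vertex \<open>x/o\<close> is the pair \<open>(x, o)\<close>, and \<open>y[v\<^sub>1,\<dots>,v\<^sub>n]\<close> is the substitution of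
  \<open>map_of [v\<^sub>1,\<dots>,v\<^sub>n]\<close> in \<open>y\<close>. Only when two vertices bind the same variable does this depend on
  their order; such pairs are non-edges anyway.\<close>

definition vertices ::
    "('p, 'f, 'x, 'o, 'e) lang \<Rightarrow> ('p, 'f, 'x, 'o, 'e) action \<Rightarrow> ('x \<times> 'o) set" where
  "vertices L a = action_vars L a \<times> objs L"

definition unordered_pairs :: "'v set \<Rightarrow> 'v set set" where
  "unordered_pairs V = {{v, v'} | v v'. v \<in> V \<and> v' \<in> V}"

fun matches :: "('p, 'x, 'o) atom \<Rightarrow> ('p, 'x, 'o) atom \<Rightarrow> bool" where
  "matches (Atom P ts) (Atom P' ts') \<longleftrightarrow>
     P = P' \<and> list_all2 (\<lambda>t t'. is_Var t \<or> is_Var t' \<or> t = t') ts ts'"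

definition ground_atoms :: "('p, 'f, 'o) state \<Rightarrow> ('p, 'x, 'o) atom set" where
  "ground_atoms S = {Atom P (map Obj os) | P os. (P, os) \<in> facts S}"

definition incons_neq ::
    "('p, 'f, 'x, 'o, 'e) lang \<Rightarrow> ('p, 'f, 'x, 'o, 'e) action \<Rightarrow> ('x \<times> 'o) set set" where
  "incons_neq L a =
     {{(x, o1), (x, o2)} | x o1 o2. x \<in> action_vars L a \<and> o1 \<in> objs L \<and> o2 \<in> objs L}"

definition incons_pos ::
    "('p, 'f, 'x, 'o, 'e) lang \<Rightarrow> ('p, 'f, 'x, 'o, 'e) action \<Rightarrow> ('p, 'f, 'o) state
      \<Rightarrow> ('x \<times> 'o) set set" where
  "incons_pos L a S =
     {{v, v'} | v v'. v \<in> vertices L a \<and> v' \<in> vertices L a \<and>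
        (\<exists>p\<in>pos_pre a. \<forall>g\<in>ground_atoms S. \<not> matches (subst_atom (map_of [v, v']) p) g)}"

definition incons_neg ::
    "('p, 'f, 'x, 'o, 'e) lang \<Rightarrow> ('p, 'f, 'x, 'o, 'e) action \<Rightarrow> ('p, 'f, 'o) state
      \<Rightarrow> ('x \<times> 'o) set set" where
  "incons_neg L a S =
     {{v, v'} | v v'. v \<in> vertices L a \<and> v' \<in> vertices L a \<and>
        (\<exists>p\<in>neg_pre a. atom_vars (subst_atom (map_of [v, v']) p) = {} \<and>
                       subst_atom (map_of [v, v']) p \<in> ground_atoms S)}"

definition incons_num ::
    "('p, 'f, 'x, 'o, 'e) lang \<Rightarrow> ('p, 'f, 'x, 'o, 'e) action \<Rightarrow> ('p, 'f, 'o) state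
      \<Rightarrow> ('x \<times> 'o) set set" where
  "incons_num L a S =
     {{v, v'} | v v'. v \<in> vertices L a \<and> v' \<in> vertices L a \<and>
        (\<exists>c\<in>num_pre a. \<not> relaxed_constr L S (subst_constr (map_of [v, v']) c))}"

definition edges ::
    "('p, 'f, 'x, 'o, 'e) lang \<Rightarrow> ('p, 'f, 'x, 'o, 'e) action \<Rightarrow> ('p, 'f, 'o) state
      \<Rightarrow> ('x \<times> 'o) set set" where
  "edges L a S = unordered_pairs (vertices L a)
     - (incons_neq L a \<union> incons_pos L a S \<union> incons_neg L a S \<union> incons_num L a S)"

text \<open>The edge set of the substitution consistency graph that ignores numeric constraints.\<close>

definition literal_edges ::
    "('p, 'f, 'x, 'o, 'e) lang \<Rightarrow> ('p, 'f, 'x, 'o, 'e) action \<Rightarrow> ('p, 'f, 'o) state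
      \<Rightarrow> ('x \<times> 'o) set set" where
  "literal_edges L a S = unordered_pairs (vertices L a)
     - (incons_neq L a \<union> incons_pos L a S \<union> incons_neg L a S)"

definition clique :: "'v set \<Rightarrow> 'v set set \<Rightarrow> nat \<Rightarrow> 'v set \<Rightarrow> bool" where
  "clique V E k C \<longleftrightarrow> C \<subseteq> V \<and> finite C \<and> card C = k \<and>
     (\<forall>v\<in>C. \<forall>v'\<in>C. v \<noteq> v' \<longrightarrow> {v, v'} \<in> E)"

end

theory Submission
  imports Defs
begin

text \<open>On ground expressions the relaxation is exact: every assignment set is a singleton or empty,
  and so is every interval computed from it. On arbitrary expressions it is sound: an extension of
  the substitution can only select values from the intervals. A \<open>k\<close>-clique binds every variable of
  the action exactly once, so a constraint with at most two variables is already ground under some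
  edge of the clique, where exactness applies; soundness, applied to every edge, gives the
  converse.\<close>

subsection \<open>Substitutions\<close>

lemma vars_subst_trm: "set1_trm (subst_trm \<sigma> t) = set1_trm t - dom \<sigma>"
  by (cases t) (auto split: option.splits)

lemma args_vars_subst: "args_vars (map (subst_trm \<sigma>) ts) = args_vars ts - dom \<sigma>"
  by (auto simp: args_vars_def vars_subst_trm)

lemma fexpr_vars_subst: "fexpr_vars (subst_fexpr \<sigma> e) = fexpr_vars e - dom \<sigma>"
proof (induction e)
  case (FT f)
  then show ?case by (cases f) (simp add: args_vars_subst)
qed auto

lemma constr_vars_subst: "constr_vars (subst_constr \<sigma> c) = constr_vars c - dom \<sigma>"
  by (cases c) (auto simp: fexpr_vars_subst)

lemma subst_trm_cong: "(\<And>x. x \<in> set1_trm t \<Longrightarrow> \<rho> x = \<sigma> x) \<Longrightarrow> subst_trm \<rho> t = subst_trm \<sigma> t"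
  by (cases t) auto

lemma subst_fexpr_cong:
  "(\<And>x. x \<in> fexpr_vars e \<Longrightarrow> \<rho> x = \<sigma> x) \<Longrightarrow> subst_fexpr \<rho> e = subst_fexpr \<sigma> e"
proof (induction e)
  case (FT f)
  then show ?case
    by (cases f) (auto simp: args_vars_def intro!: subst_trm_cong)
qed auto

lemma subst_constr_cong:
  "(\<And>x. x \<in> constr_vars c \<Longrightarrow> \<rho> x = \<sigma> x) \<Longrightarrow> subst_constr \<rho> c = subst_constr \<sigma> c"
  by (cases c) (auto intro!: subst_fexpr_cong)

lemma wf_args_subst:
  assumes "wf_args Os m ts" "ran \<sigma> \<subseteq> Os"
  shows "wf_args Os m (map (subst_trm \<sigma>) ts)"
proof -
  have "set2_trm (subst_trm \<sigma> t) \<subseteq> Os" if "t \<in> set ts" for t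
    using assms that by (cases t) (auto simp: wf_args_def ran_def split: option.splits)
  then show ?thesis using assms(1) by (simp add: wf_args_def)
qed

lemma wf_fexpr_subst: "wf_fexpr L e \<Longrightarrow> ran \<sigma> \<subseteq> objs L \<Longrightarrow> wf_fexpr L (subst_fexpr \<sigma> e)"
proof (induction e)
  case (FT f)
  then show ?case by (cases f) (simp add: wf_args_subst)
qed auto

lemma wf_constr_subst:
  "wf_condition L (Num c) \<Longrightarrow> ran \<sigma> \<subseteq> objs L \<Longrightarrow> wf_condition L (Num (subst_constr \<sigma> c))"
  by (cases c) (simp add: wf_fexpr_subst)

subsection \<open>Assignment sets\<close>

lemma subset_interval_hull: "A \<subseteq> interval_hull A"
  by (auto simp: interval_hull_def Inf_lower Sup_upper)

text \<open>The hull of one point is that point, and the hull of nothing is empty. Writing an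
  optional value as \<open>set_option u\<close> covers defined and undefined results by one
  equation.\<close>

lemma interval_hull_set_option:
  "interval_hull (ereal ` set_option u) = ereal ` set_option u"
  by (cases u) (auto simp: interval_hull_def)

text \<open>This passes from the numbered variables of the generic term to the argument lists that
  \<open>fvals\<close> expects. The \<open>the\<close> is harmless, since \<rho> is defined at every
  position below the arity.\<close>

lemma fterm_val_generic:
  assumes "\<rho> \<in> substs {..<fun_arity L F} Os"
  shows "fterm_val S (subst_fterm \<rho> (generic_fterm L F)) =
    fvals S (F, map (\<lambda>i. the (\<rho> i)) [0..<fun_arity L F])"
proof -
  have *: "subst_trm \<rho> (Var i) = Obj (the (\<rho> i))" if "i < fun_arity L F" for i
    using assms that by (auto simp: substs_def split: option.splits)
  then have "map (subst_trm \<rho>) (map Var [0..<fun_arity L F]) =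
      map (\<lambda>i. Obj (the (\<rho> i))) [0..<fun_arity L F]"
    by (simp del: subst_trm.simps)
  then show ?thesis
    by (simp add: generic_fterm_def args_vars_def del: map_map) (simp add: comp_def)
qed

lemma ground_trm: "set1_trm t = {} \<Longrightarrow> t = Obj (the_obj t)"
  by (cases t) auto

lemma obj_positions_ground:
  assumes "args_vars ts = {}"
  shows "obj_positions ts = (\<lambda>i. if i < length ts then Some (the_obj (ts ! i)) else None)"
proof
  fix i
  have "ts ! i = Obj (the_obj (ts ! i))" if "i < length ts"
    using assms that by (intro ground_trm) (auto simp: args_vars_def)
  then show "obj_positions ts i = (if i < length ts then Some (the_obj (ts ! i)) else None)"
    by (auto simp: obj_positions_def split: trm.splits)
qed

lemma obj_positions_ground_substs:
  assumes "args_vars ts = {}" "the_obj ` set ts \<subseteq> Os"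
  shows "obj_positions ts \<in> substs {..<length ts} Os"
  using assms(2)
  by (auto simp: obj_positions_ground[OF assms(1)] substs_def dom_def ran_def split: if_splits)

text \<open>Instantiating the generic term by the objects found at the positions of a ground
  argument list rebuilds that list.\<close>

lemma fterm_val_obj_positions:
  assumes "args_vars ts = {}" "the_obj ` set ts \<subseteq> Os" "length ts = fun_arity L F"
  shows "fterm_val S (subst_fterm (obj_positions ts) (generic_fterm L F)) =
    fterm_val S (FTerm F ts)"
proof -
  have "map (\<lambda>i. the (obj_positions ts i)) [0..<length ts] = map the_obj ts"
    by (auto simp: obj_positions_ground[OF assms(1)] intro!: nth_equalityI)
  then show ?thesis
    using fterm_val_generic obj_positions_ground_substs[OF assms(1,2)] assms(1,3) by fastforce
qed

text \<open>When every position holds an object, nothing is left to range over, so the hull is taken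
  over at most one value.\<close>

lemma assignment_set_ground:
  assumes "args_vars ts = {}" "wf_args (objs L) (fun_arity L F) ts"
  shows "assignment_set L S F (obj_positions ts) = ereal ` set_option (fterm_val S (FTerm F ts))"
proof -
  let ?\<rho> = "obj_positions ts"
  have len: "length ts = fun_arity L F" using assms(2) by (simp add: wf_args_def)
  have objs: "the_obj ` set ts \<subseteq> objs L"
  proof
    fix ob assume "ob \<in> the_obj ` set ts"
    then obtain t where t: "t \<in> set ts" "ob = the_obj t" by auto
    then have "t = Obj ob" using assms(1) ground_trm[of t] by (auto simp: args_vars_def)
    then show "ob \<in> objs L" using t(1) assms(2) by (force simp: wf_args_def)
  qed
  have \<rho>: "?\<rho> \<in> substs {..<fun_arity L F} (objs L)"
    using obj_positions_ground_substs[OF assms(1) objs] len by simp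
  have "\<rho>' = ?\<rho>" if "\<rho>' \<in> substs {..<fun_arity L F} (objs L)" "?\<rho> \<subseteq>\<^sub>m \<rho>'" for \<rho>'
  proof -
    \<comment> \<open>Both maps are defined exactly on the positions below the arity, so an
      extension must coincide with \<open>?\<rho>\<close>.\<close>
    have "dom \<rho>' = dom ?\<rho>" using that(1) \<rho> by (simp add: substs_def)
    then show ?thesis using that(2) by (metis map_le_antisym map_le_def)
  qed
  then have "{ereal r | r \<rho>'. \<rho>' \<in> substs {..<fun_arity L F} (objs L) \<and> ?\<rho> \<subseteq>\<^sub>m \<rho>' \<and>
      fterm_val S (subst_fterm \<rho>' (generic_fterm L F)) = Some r} =
      {ereal r | r. fterm_val S (subst_fterm ?\<rho> (generic_fterm L F)) = Some r}"
    using \<rho> map_le_refl[of ?\<rho>] by blast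
  also have "\<dots> = ereal ` set_option (fterm_val S (FTerm F ts))"
    unfolding fterm_val_obj_positions[OF assms(1) objs len] by force
  finally show ?thesis by (simp only: assignment_set_def interval_hull_set_option)
qed

text \<open>The objects of \<open>ts'\<close> form one of the total assignments over which the hull
  for \<open>ts\<close> is taken.\<close>

lemma assignment_set_sound:
  assumes "wf_state L S" "obj_positions ts \<subseteq>\<^sub>m obj_positions ts'"
    and val: "fterm_val S (FTerm F ts') = Some r"
  shows "ereal r \<in> assignment_set L S F (obj_positions ts)"
proof -
  have ground: "args_vars ts' = {}" and "fvals S (F, map the_obj ts') = Some r"
    using val by (auto split: if_splits)
  \<comment> \<open>The term has a value, so its key lies in the domain of \<open>fvals S\<close>,
    where \<open>wf_state\<close> fixes the arity and the objects.\<close>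
  then have len: "length ts' = fun_arity L F" and objs: "the_obj ` set ts' \<subseteq> objs L"
    using assms(1) by (force simp: wf_state_def dom_def)+
  have "obj_positions ts' \<in> substs {..<fun_arity L F} (objs L)"
    using obj_positions_ground_substs[OF ground objs] len by simp
  moreover have "fterm_val S (subst_fterm (obj_positions ts') (generic_fterm L F)) = Some r"
    using fterm_val_obj_positions[OF ground objs len] val by metis
  ultimately show ?thesis
    unfolding assignment_set_def using assms(2)
    by (intro subsetD[OF subset_interval_hull]) blast
qed

text \<open>Extending a substitution turns further variables into objects but never alters an object
  already in place.\<close>

lemma obj_positions_subst_mono:
  assumes "\<rho> \<subseteq>\<^sub>m \<sigma>"
  shows "obj_positions (map (subst_trm \<rho>) ts) \<subseteq>\<^sub>m obj_positions (map (subst_trm \<sigma>) ts)"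
proof -
  have "subst_trm \<sigma> t = Obj ob" if "subst_trm \<rho> t = Obj ob" for t ob
    using assms that by (cases t) (force simp: map_le_def dom_def split: option.splits)+
  then show ?thesis
    by (auto simp: map_le_def obj_positions_def split: if_splits trm.splits)
qed

subsection \<open>Relaxed evaluation\<close>

text \<open>Finite operands exclude the indeterminate forms with infinities; division by zero is
  undefined on both sides.\<close>

lemma arith_ereal_real: "arith_ereal b (ereal r) (ereal s) = map_option ereal (arith_real b r s)"
  by (cases b) auto

lemma relaxed_fexpr_ground:
  "wf_fexpr L e \<Longrightarrow> fexpr_vars e = {} \<Longrightarrow>
    relaxed_fexpr L S e = ereal ` set_option (fexpr_val S e)"
proof (induction e)
  case (FT f)
  then show ?case
    by (cases f) (simp add: assignment_set_ground del: fterm_val.simps)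
next
  case (Arith b e e')
  \<comment> \<open>Combining two sets of at most one real each gives again at most one real, and an
    undefined operand yields the empty set. Arbitrary \<open>u\<close> and \<open>w\<close> let the
    induction hypotheses rewrite into this form.\<close>
  have "{t. \<exists>r\<in>ereal ` set_option u. \<exists>s\<in>ereal ` set_option w. arith_ereal b r s = Some t} =
      ereal ` set_option (case (u, w) of (Some r, Some s) \<Rightarrow> arith_real b r s | _ \<Rightarrow> None)"
    for u w
    by (cases u; cases w) (auto simp: arith_ereal_real)
  then show ?case
    using Arith by (simp add: interval_arith_def interval_hull_set_option)
qed

text \<open>At an operator, the values of the two operands lie in their intervals, and their result
  is among the points whose hull is formed.\<close>

lemma relaxed_fexpr_sound:
  assumes "wf_state L S" "\<rho> \<subseteq>\<^sub>m \<sigma>"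
  shows "fexpr_val S (subst_fexpr \<sigma> e) = Some r \<Longrightarrow>
    ereal r \<in> relaxed_fexpr L S (subst_fexpr \<rho> e)"
proof (induction e arbitrary: r)
  case (FT f)
  obtain F ts where "f = FTerm F ts" by (cases f)
  then show ?case
    using FT assignment_set_sound[OF assms(1) obj_positions_subst_mono[OF assms(2)]]
    by (simp del: fterm_val.simps)
next
  case (Arith b e e')
  then obtain s t where st: "fexpr_val S (subst_fexpr \<sigma> e) = Some s"
      "fexpr_val S (subst_fexpr \<sigma> e') = Some t" "arith_real b s t = Some r"
    by (auto split: option.splits)
  have "ereal s \<in> relaxed_fexpr L S (subst_fexpr \<rho> e)"
      "ereal t \<in> relaxed_fexpr L S (subst_fexpr \<rho> e')"
    using Arith.IH st by auto
  moreover have "arith_ereal b (ereal s) (ereal t) = Some (ereal r)"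
    by (simp add: arith_ereal_real st(3))
  ultimately show ?case
    unfolding subst_fexpr.simps relaxed_fexpr.simps interval_arith_def
    by (intro subsetD[OF subset_interval_hull]) blast
qed

lemma compare_ereal: "compare cmp (ereal r) (ereal s) = compare cmp r s"
  by (cases cmp) auto

text \<open>An undefined side gives an empty interval, whose comparison fails just as the constraint
  fails to hold.\<close>

lemma relaxed_constr_ground:
  assumes "wf_condition L (Num c)" "constr_vars c = {}"
  shows "relaxed_constr L S c \<longleftrightarrow> constr_holds S c"
  using assms
  by (cases c) (auto simp: relaxed_fexpr_ground interval_compare_def compare_ereal)

lemma relaxed_constr_sound:
  assumes "wf_state L S" "\<rho> \<subseteq>\<^sub>m \<sigma>" "constr_holds S (subst_constr \<sigma> c)"
  shows "relaxed_constr L S (subst_constr \<rho> c)"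
proof (cases c)
  case (Constr cmp e e')
  then show ?thesis
    using assms(3) relaxed_fexpr_sound[OF assms(1,2)]
    by (force simp: interval_compare_def compare_ereal)
qed

subsection \<open>Cliques\<close>

lemma edges_eq: "edges L a S = literal_edges L a S - incons_num L a S"
  by (auto simp: edges_def literal_edges_def)

text \<open>Two distinct vertices over the same variable would form a pair in
  \<open>incons_neq\<close>.\<close>

lemma literal_clique_inj:
  assumes "clique (vertices L a) (literal_edges L a S) k C"
  shows "inj_on fst C"
proof (rule inj_onI, rule ccontr)
  fix v v' assume v: "v \<in> C" "v' \<in> C" "fst v = fst v'" "v \<noteq> v'"
  then have "v \<in> vertices L a" "v' \<in> vertices L a" "{v, v'} \<notin> incons_neq L a"
    using assms by (auto simp: clique_def literal_edges_def)
  then show False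
    using v(3) unfolding incons_neq_def vertices_def by (cases v; cases v') auto
qed

text \<open>By injectivity the clique binds \<open>k\<close> different variables, and the action has
  only \<open>k\<close>.\<close>

lemma literal_clique_fst_image:
  assumes "clique (vertices L a) (literal_edges L a S) k C"
    and "k = card (action_vars L a)" "finite (action_vars L a)"
  shows "fst ` C = action_vars L a"
proof (rule card_subset_eq)
  show "fst ` C \<subseteq> action_vars L a"
    using assms(1) by (auto simp: clique_def vertices_def)
  show "card (fst ` C) = card (action_vars L a)"
    using card_image[OF literal_clique_inj[OF assms(1)]] assms(1,2) by (simp add: clique_def)
qed (fact assms(3))

text \<open>An unordered pair may enter \<open>incons_num\<close> through either ordering of its
  vertices. For different variables both orderings give the same substitution, so the given one
  suffices.\<close>

lemma incons_num_iff:
  assumes "v \<in> vertices L a" "v' \<in> vertices L a" "fst v \<noteq> fst v'"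
  shows "{v, v'} \<in> incons_num L a S \<longleftrightarrow>
    (\<exists>c\<in>num_pre a. \<not> relaxed_constr L S (subst_constr (map_of [v, v']) c))"
proof -
  have "map_of [v', v] = map_of [v, v']"
    using assms(3) by (cases v; cases v') (auto simp: fun_upd_twist)
  then show ?thesis
    using assms(1,2) by (simp only: incons_num_def mem_Collect_eq doubleton_eq_iff) metis
qed

text \<open>The clique is given as a list because \<open>map_of\<close> needs an order;
  \<open>distinct\<close> makes its keys distinct once \<open>fst\<close> is injective on its
  elements.\<close>

lemma clique_edges_iff:
  fixes L :: "('p, 'f, 'x, 'o, 'e) lang"
    and a :: "('p, 'f, 'x, 'o, 'e) action"
  assumes wf: "wf_action L a" "wf_state L S"
    and k: "k = card (action_vars L a)" "k \<ge> 2"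
    and arity: "\<forall>c\<in>num_pre a. card (constr_vars c) \<le> 2"
    and "distinct vs"
  shows "clique (vertices L a) (edges L a S) k (set vs) \<longleftrightarrow>
    clique (vertices L a) (literal_edges L a S) k (set vs) \<and>
    (\<forall>c\<in>num_pre a. constr_holds S (subst_constr (map_of vs) c))"
proof (cases "clique (vertices L a) (literal_edges L a S) k (set vs)")
  case False
  then show ?thesis by (auto simp: clique_def edges_eq)
next
  case True
  \<comment> \<open>An infinite set has \<open>card\<close> equal to 0, which
    \<open>k \<ge> 2\<close> excludes.\<close>
  have fin: "finite (action_vars L a)" using k by (auto intro: card_ge_0_finite)
  have inj: "inj_on fst (set vs)" by (rule literal_clique_inj[OF True])
  have cover: "fst ` set vs = action_vars L a" by (rule literal_clique_fst_image[OF True k(1) fin])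
  have V: "set vs \<subseteq> vertices L a" using True by (simp add: clique_def)
  have map_of_vs: "map_of vs (fst v) = Some (snd v)" if "v \<in> set vs" for v
    using that inj \<open>distinct vs\<close> by (simp add: distinct_map)
  \<comment> \<open>The substitution of an edge is a restriction of that of the whole
    clique.\<close>
  have pair_le: "map_of [v, v'] \<subseteq>\<^sub>m map_of vs" if "v \<in> set vs" "v' \<in> set vs" for v v'
    using map_of_vs[OF that(1)] map_of_vs[OF that(2)]
    by (cases v; cases v') (auto simp: map_le_def)
  have pair_ran: "ran (map_of [v, v']) \<subseteq> objs L" if "v \<in> set vs" "v' \<in> set vs" for v v'
    using that V by (cases v; cases v') (auto simp: ran_def vertices_def split: if_splits)
  have neq: "fst v \<noteq> fst v'" if "v \<in> set vs" "v' \<in> set vs" "v \<noteq> v'" for v v'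
    using that inj by (auto dest: inj_onD)
  have "clique (vertices L a) (edges L a S) k (set vs) \<longleftrightarrow>
      (\<forall>v\<in>set vs. \<forall>v'\<in>set vs. v \<noteq> v' \<longrightarrow> {v, v'} \<notin> incons_num L a S)"
    using True by (auto simp: clique_def edges_eq)
  also have "\<dots> \<longleftrightarrow> (\<forall>v\<in>set vs. \<forall>v'\<in>set vs. v \<noteq> v' \<longrightarrow>
      (\<forall>c\<in>num_pre a. relaxed_constr L S (subst_constr (map_of [v, v']) c)))" (is "_ \<longleftrightarrow> ?relaxed")
    using V neq incons_num_iff[of _ L a _ S] by (metis (no_types, lifting) subsetD)
  also have "\<dots> \<longleftrightarrow> (\<forall>c\<in>num_pre a. constr_holds S (subst_constr (map_of vs) c))"
  proof
    assume relaxed: ?relaxed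
    show "\<forall>c\<in>num_pre a. constr_holds S (subst_constr (map_of vs) c)"
    proof
      fix c assume c: "c \<in> num_pre a"
      then have pre: "Num c \<in> pre a" by (simp add: num_pre_def)
      then have vars: "constr_vars c \<subseteq> action_vars L a"
        by (force simp: action_vars_def)
      \<comment> \<open>A constraint with fewer than two variables is padded to a set of exactly
        two, possible since \<open>k \<ge> 2\<close>, so that an actual edge between distinct
        vertices can be chosen.\<close>
      have "\<exists>X. constr_vars c \<subseteq> X \<and> X \<subseteq> action_vars L a \<and> card X = 2"
        using exists_subset_between[of "constr_vars c" 2 "action_vars L a"] arity c k vars fin
        by blast
      then obtain x y where xy: "constr_vars c \<subseteq> {x, y}" "{x, y} \<subseteq> action_vars L a" "x \<noteq> y"
        by (metis card_2_iff)
      then obtain v v' where v: "v \<in> set vs" "v' \<in> set vs" "fst v = x" "fst v' = y"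
        unfolding cover[symmetric] by auto
      let ?\<rho> = "map_of [v, v']"
      have dom: "dom ?\<rho> = {x, y}" using v by (cases v; cases v') auto
      have "v \<noteq> v'" using v(3,4) xy(3) by auto
      then have "relaxed_constr L S (subst_constr ?\<rho> c)" using relaxed v(1,2) c by blast
      moreover have "wf_condition L (Num (subst_constr ?\<rho> c))"
        using wf(1) pre wf_constr_subst[OF _ pair_ran[OF v(1,2)]] by (simp add: wf_action_def)
      moreover have "constr_vars (subst_constr ?\<rho> c) = {}"
        using xy(1) dom by (auto simp: constr_vars_subst)
      ultimately have "constr_holds S (subst_constr ?\<rho> c)"
        using relaxed_constr_ground by blast
      \<comment> \<open>The edge already binds every variable of \<open>c\<close>, and the remaining
        vertices change nothing in it.\<close>
      moreover have "subst_constr ?\<rho> c = subst_constr (map_of vs) c"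
        using pair_le[OF v(1,2)] xy(1) dom unfolding map_le_def
        by (intro subst_constr_cong) blast
      ultimately show "constr_holds S (subst_constr (map_of vs) c)" by simp
    qed
  next
    assume "\<forall>c\<in>num_pre a. constr_holds S (subst_constr (map_of vs) c)"
    then show ?relaxed
      using relaxed_constr_sound[OF wf(2) pair_le] by blast
  qed
  finally show ?thesis using True by blast
qed

theorem corollary4:
  fixes L :: "('p, 'f, 'x, 'o, 'e) lang"
    and a :: "('p, 'f, 'x, 'o, 'e) action"
    and S :: "('p, 'f, 'o) state"
    and k :: nat
  assumes "\<forall>F. fun_arity L F \<le> 2"
    and "wf_action L a"
    and "wf_state L S"
    and "k = card (action_vars L a)"
    and "k \<ge> 2"
    and "\<forall>c\<in>num_pre a. card (constr_vars c) \<le> 2"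
  shows "((\<exists>C. clique (vertices L a) (edges L a S) k C) \<longleftrightarrow>
          (\<exists>vs. distinct vs \<and> clique (vertices L a) (literal_edges L a S) k (set vs) \<and>
                (\<forall>c\<in>num_pre a. constr_holds S (subst_constr (map_of vs) c)))) \<and>
         (\<forall>vs. distinct vs \<longrightarrow>
            (clique (vertices L a) (edges L a S) k (set vs) \<longleftrightarrow>
             clique (vertices L a) (literal_edges L a S) k (set vs) \<and>
             (\<forall>c\<in>num_pre a. constr_holds S (subst_constr (map_of vs) c))))"
proof -
  have iff: "clique (vertices L a) (edges L a S) k (set vs) \<longleftrightarrow>
      clique (vertices L a) (literal_edges L a S) k (set vs) \<and>
      (\<forall>c\<in>num_pre a. constr_holds S (subst_constr (map_of vs) c))" if "distinct vs" for vs
    using clique_edges_iff assms that by blast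
  \<comment> \<open>Cliques are finite, so each can be listed without repetition.\<close>
  have "(\<exists>C. clique (vertices L a) (edges L a S) k C) \<longleftrightarrow>
      (\<exists>vs. distinct vs \<and> clique (vertices L a) (edges L a S) k (set vs))"
    by (metis clique_def finite_distinct_list)
  then show ?thesis using iff by blast
qed

end
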